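(* Let $I=[a,b]$ be partitioned as in the context. For all $\phi^h\in\widetilde S(I)$ and $\hat\phi^h=(\hat\phi^h(a),\hat\phi^h(b))^\intercal\in\widetilde G(\partial I)$, the dual degrees of freedom of the weak derivative $\widetilde{\frac{\mathrm d}{\mathrm dx}}(\phi^h,\hat\phi^h)\in\widetilde G(I)$ are $$\widetilde{\mathcal N}^1\Big(\widetilde{\tfrac{\mathrm d}{\mathrm dx}}(\phi^h,\hat\phi^h)\Big)=-(\mathbb E^{1,0})^\intercal\,\widetilde{\mathcal N}^0(\phi^h)+\mathbb N\,\widetilde{\mathcal B}^0(\hat\phi^h).$$
   Context: Let $a=x_0<x_1<\dots<x_{K_{el}}=b$ and $I_k=[x_{k-1},x_k]$, and let $N\ge1$. $G(I)\subset H^1(I)$ is the space of continuous functions that are polynomials of degree at most $N$ on each $I_k$; $S(I)\subset L^2(I)$ is the space of functions that are polynomials of degree at most $N-1$ on each $I_k$. On $[-1,1]$ take the Gauss–Lobatto–Legendre nodes (roots of $(1-\xi^2)L_N'(\xi)$, $L_N$ the Legendre polynomial), and map them affinely to every $I_k$; this gives global nodes $a=y_0<y_1<\dots<y_{M}=b$, $M=NK_{el}$. For $q^h\in G(I)$, $\mathcal N^0(q^h)=(q^h(y_0),\dots,q^h(y_M))^\intercal$; for $p^h\in S(I)$, $\mathcal N^1(p^h)=(\int_{y_{i-1}}^{y_i}p^h\,\mathrm dx)_{i=1}^M$. $\Psi^0$, $\Psi^1$ are the row vectors of basis functions of $G(I)$, $S(I)$ with $q^h=\Psi^0\mathcal N^0(q^h)$,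 $p^h=\Psi^1\mathcal N^1(p^h)$ (piecewise Lagrange and piecewise edge polynomials). $\mathbb M^{(k)}=\int_I(\Psi^k)^\intercal\Psi^k\,\mathrm dx$, dual bases $\widetilde\Psi^{1-k}=\Psi^k(\mathbb M^{(k)})^{-1}$, dual degrees of freedom $\widetilde{\mathcal N}^{1-k}=\mathbb M^{(k)}\mathcal N^k$; $\widetilde G(I)$, $\widetilde S(I)$ are $G(I)$, $S(I)$ with elements expanded in $\widetilde\Psi^1$, $\widetilde\Psi^0$. $\widetilde G(\partial I)$ is the space of pairs of values at $a$ and $b$, and $\widetilde{\mathcal B}^0(\hat\phi^h)=(\hat\phi^h(a),\hat\phi^h(b))^\intercal$. $\mathbb E^{1,0}$ is the $M\times(M+1)$ matrix whose $i$-th row ($i=1,\dots,M$) has $-1$ in column $i-1$, $+1$ in column $i$ (columns numbered $0,\dots,M$) and zeros elsewhere. $\mathbb N$ is the $(M+1)\times2$ matrix with entry $-1$ at (first row, first column), $+1$ at (last row, second column), and zeros elsewhere. The weak derivative $\widetilde{\frac{\mathrm d}{\mathrm dx}}:\widetilde S(I)\times\widetilde G(\partial I)\to\widetilde G(I)$ is defined by $$\int_I\Big(\widetilde{\tfrac{\mathrm d}{\mathrm dx}}(\phi^h,\hat\phi^h)\Big)q^h\,\mathrm dx=\int_I\phi^h\Big(-\tfrac{\mathrm dq^h}{\mathrm dx}\Big)\mathrm dx+\hat\phi^h(x)q^h(x)\Big|_a^b\qquad\forall q^h\in G(I).$$ *)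

theory Defs
  imports "HOL-Analysis.Analysis" "HOL-Computational_Algebra.Polynomial" "Jordan_Normal_Form.Matrix"
begin

text \<open>
  A mesh of \<open>I = [x 0, x K]\<close> is given by its breakpoints \<open>x 0 < ... < x K\<close>; element number
  \<open>k < K\<close> is \<open>[x k, x (Suc k)]\<close>. The polynomial degree is \<open>N\<close>, and vectors and matrices are
  indexed from 0, so that the \<open>i\<close>-th nodal interval \<open>[y i, y (Suc i)]\<close> has index \<open>i < N * K\<close>.
\<close>

definition legendre :: "nat \<Rightarrow> real poly" where
  \<comment> \<open>Rodrigues' formula\<close>
  "legendre n = Polynomial.smult (1 / (2 ^ n * fact n)) ((pderiv ^^ n) ([:-1, 0, 1:] ^ n))"

definition gll_nodes :: "nat \<Rightarrow> real list" where
  "gll_nodes N = sorted_list_of_set {\<xi>. (1 - \<xi>\<^sup>2) * poly (pderiv (legendre N)) \<xi> = 0}"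

text \<open>
  For \<open>i = N * K\<close> the formula below mentions \<open>x (Suc K)\<close>, but with the factor \<open>\<xi>\<^sub>0 + 1 = 0\<close>;
  hence \<open>y (N * K) = x K\<close>.
\<close>

definition node :: "(nat \<Rightarrow> real) \<Rightarrow> nat \<Rightarrow> nat \<Rightarrow> real" where
  "node x N i =
     x (i div N) + (x (Suc (i div N)) - x (i div N)) * ((gll_nodes N ! (i mod N) + 1) / 2)"

definition G_space :: "(nat \<Rightarrow> real) \<Rightarrow> nat \<Rightarrow> nat \<Rightarrow> (real \<Rightarrow> real) set" where
  "G_space x K N = {q \<in> extensional {x 0..x K}. continuous_on {x 0..x K} q \<and>
     (\<forall>k<K. \<exists>p. Polynomial.degree p \<le> N \<and> (\<forall>t\<in>{x k..x (Suc k)}. q t = poly p t))}"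

text \<open>
  Elements of \<open>S(I)\<close> are \<open>L\<^sup>2\<close> classes. Here \<open>S_space\<close> contains all their representatives: the
  values at breakpoints and outside \<open>I\<close> are arbitrary and never matter.
\<close>

definition S_space :: "(nat \<Rightarrow> real) \<Rightarrow> nat \<Rightarrow> nat \<Rightarrow> (real \<Rightarrow> real) set" where
  "S_space x K N = {f.
     \<forall>k<K. \<exists>p. Polynomial.degree p \<le> N - 1 \<and> (\<forall>t\<in>{x k<..<x (Suc k)}. f t = poly p t)}"

text \<open>The dual spaces are the same function spaces, only expanded in other bases.\<close>

abbreviation "dual_G_space \<equiv> G_space"
abbreviation "dual_S_space \<equiv> S_space"

definition dof0 :: "(nat \<Rightarrow> real) \<Rightarrow> nat \<Rightarrow> nat \<Rightarrow> (real \<Rightarrow> real) \<Rightarrow> real vec" where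
  "dof0 x K N q = Matrix.vec (N * K + 1) (\<lambda>i. q (node x N i))"

definition dof1 :: "(nat \<Rightarrow> real) \<Rightarrow> nat \<Rightarrow> nat \<Rightarrow> (real \<Rightarrow> real) \<Rightarrow> real vec" where
  "dof1 x K N f = Matrix.vec (N * K) (\<lambda>i. integral {node x N i..node x N (Suc i)} f)"

text \<open>
  Local polynomials on element \<open>k\<close>: the Lagrange polynomials \<open>h\<^sub>j\<close> (\<open>j \<le> N\<close>) of its nodes, and the
  edge polynomials \<open>e\<^sub>j = - (h\<^sub>0' + ... + h\<^sub>j')\<close> (\<open>j < N\<close>), which have integral 1 over the \<open>j\<close>-th
  nodal interval of the element and integral 0 over its other nodal intervals.
\<close>

definition lagrange_poly :: "(nat \<Rightarrow> real) \<Rightarrow> nat \<Rightarrow> nat \<Rightarrow> nat \<Rightarrow> real poly" where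
  "lagrange_poly x N k j = (\<Prod>m\<in>{..N} - {j}.
     Polynomial.smult (1 / (node x N (k * N + j) - node x N (k * N + m))) [:- node x N (k * N + m), 1:])"

definition edge_poly :: "(nat \<Rightarrow> real) \<Rightarrow> nat \<Rightarrow> nat \<Rightarrow> nat \<Rightarrow> real poly" where
  "edge_poly x N k j = - (\<Sum>m\<le>j. pderiv (lagrange_poly x N k m))"

definition element_of :: "(nat \<Rightarrow> real) \<Rightarrow> real \<Rightarrow> nat" where
  \<comment> \<open>a breakpoint is attributed to the element on its left\<close>
  "element_of x t = (LEAST k. t \<le> x (Suc k))"

definition basis0 :: "(nat \<Rightarrow> real) \<Rightarrow> nat \<Rightarrow> nat \<Rightarrow> nat \<Rightarrow> real \<Rightarrow> real" where
  "basis0 x K N i = (\<lambda>t\<in>{x 0..x K}. let k = element_of x t in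
     if k * N \<le> i \<and> i \<le> Suc k * N then poly (lagrange_poly x N k (i - k * N)) t else 0)"

definition basis1 :: "(nat \<Rightarrow> real) \<Rightarrow> nat \<Rightarrow> nat \<Rightarrow> nat \<Rightarrow> real \<Rightarrow> real" where
  "basis1 x K N i = (\<lambda>t\<in>{x 0..x K}. let k = element_of x t in
     if k * N \<le> i \<and> i < Suc k * N then poly (edge_poly x N k (i - k * N)) t else 0)"

definition mass0 :: "(nat \<Rightarrow> real) \<Rightarrow> nat \<Rightarrow> nat \<Rightarrow> real mat" where
  "mass0 x K N = Matrix.mat (N * K + 1) (N * K + 1)
     (\<lambda>(i, j). integral {x 0..x K} (\<lambda>t. basis0 x K N i t * basis0 x K N j t))"

definition mass1 :: "(nat \<Rightarrow> real) \<Rightarrow> nat \<Rightarrow> nat \<Rightarrow> real mat" where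
  "mass1 x K N = Matrix.mat (N * K) (N * K)
     (\<lambda>(i, j). integral {x 0..x K} (\<lambda>t. basis1 x K N i t * basis1 x K N j t))"

text \<open>The superscript of a dual degree of freedom is complementary to that of the primal one.\<close>

definition dual_dof1 :: "(nat \<Rightarrow> real) \<Rightarrow> nat \<Rightarrow> nat \<Rightarrow> (real \<Rightarrow> real) \<Rightarrow> real vec" where
  "dual_dof1 x K N q = mass0 x K N *\<^sub>v dof0 x K N q"

definition dual_dof0 :: "(nat \<Rightarrow> real) \<Rightarrow> nat \<Rightarrow> nat \<Rightarrow> (real \<Rightarrow> real) \<Rightarrow> real vec" where
  "dual_dof0 x K N f = mass1 x K N *\<^sub>v dof1 x K N f"

text \<open>An element of the boundary space is the pair of its values at the left and right ends.\<close>

definition boundary_dof :: "real \<times> real \<Rightarrow> real vec" where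
  "boundary_dof bd = vec_of_list [fst bd, snd bd]"

definition incidence_mat :: "nat \<Rightarrow> real mat" where
  "incidence_mat M = Matrix.mat M (M + 1)
     (\<lambda>(i, j). if j = i then -1 else if j = Suc i then 1 else 0)"

definition boundary_mat :: "nat \<Rightarrow> real mat" where
  "boundary_mat M = Matrix.mat (M + 1) 2
     (\<lambda>(i, j). if i = 0 \<and> j = 0 then -1 else if i = M \<and> j = 1 then 1 else 0)"

text \<open>
  For \<open>q\<close> in \<open>G(I)\<close> the classical derivative may fail to exist at the breakpoints only, which
  form a null set. The function is unique because the members of \<open>G_space\<close> are extensional.
\<close>

definition weak_deriv ::
  "(nat \<Rightarrow> real) \<Rightarrow> nat \<Rightarrow> nat \<Rightarrow> (real \<Rightarrow> real) \<Rightarrow> real \<times> real \<Rightarrow> real \<Rightarrow> real" where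
  "weak_deriv x K N \<phi> bd = (THE \<psi>. \<psi> \<in> dual_G_space x K N \<and>
     (\<forall>q\<in>G_space x K N.
        integral {x 0..x K} (\<lambda>t. \<psi> t * q t) =
        integral {x 0..x K} (\<lambda>t. \<phi> t * (- deriv q t))
          + (snd bd * q (x K) - fst bd * q (x 0))))"

end

theory Submission
  imports Defs "Jordan_Normal_Form.Determinant"
begin

text \<open>
  The mass matrix of \<open>G(I)\<close> is positive definite, so a member of \<open>G(I)\<close> exists with any prescribed
  dual degrees of freedom and is determined by them; these are its moments against the nodal basis.
  Hence the weak derivative is the member whose moments are the right-hand sides of the weak form
  tested with the nodal basis functions. On every element the derivative of the \<open>i\<close>-th nodal
  function is \<open>e (i - 1) - e i\<close> with edge functions \<open>e\<close>, and the moment of \<open>\<phi>\<close> against \<open>e j\<close> is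
  the \<open>j\<close>-th dual degree of freedom of \<open>\<phi>\<close>; this gives the incidence matrix. The two boundary
  values reach only the first and last nodal functions.
\<close>

section \<open>Gauss-Lobatto-Legendre nodes\<close>

text \<open>Induction that adds a new maximum \<open>b\<close> to the roots: the mean value theorem
  between the old maximum and \<open>b\<close> yields a critical point \<open>c\<close>, which is
  new because all earlier ones lie below the old maximum. The strict bounds keep the roots of
  iterated derivatives inside an open interval.\<close>

lemma Rolle_poly_roots:
  fixes p :: "real poly"
  assumes "finite A" "A \<noteq> {}" "\<forall>r\<in>A. poly p r = 0"
  shows "\<exists>B. finite B \<and> Suc (card B) = card A \<and>
    (\<forall>r\<in>B. poly (pderiv p) r = 0 \<and> Min A < r \<and> r < Max A)"
  using assms
proof (induction A rule: finite_linorder_max_induct)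
  case empty
  then show ?case by simp
next
  case (insert b A)
  show ?case
  proof (cases "A = {}")
    case True
    then show ?thesis by (intro exI[of _ "{}"]) auto
  next
    case False
    then obtain B where B: "finite B" "Suc (card B) = card A"
      "\<forall>r\<in>B. poly (pderiv p) r = 0 \<and> Min A < r \<and> r < Max A"
      using insert by auto
    have mA: "Max A \<in> A" "Min A \<in> A" "Min A \<le> Max A" "Max A < b"
      using insert.hyps False by auto
    from poly_MVT[OF mA(4), of p] obtain c where
      c: "Max A < c" "c < b" "poly p b - poly p (Max A) = (b - Max A) * poly (pderiv p) c"
      by auto
    have c0: "poly (pderiv p) c = 0"
      using c(3) insert.prems mA by auto
    have "Min A \<le> b" using mA(3,4) by linarith
    then have mm: "Max (insert b A) = b" "Min (insert b A) = Min A"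
      using insert.hyps False mA(1) by (auto simp: min_absorb2 intro!: Max_eqI less_imp_le)
    show ?thesis
    proof (intro exI conjI)
      have "c \<notin> B" "b \<notin> A" using B(3) c(1) insert.hyps by force+
      then show "Suc (card (insert c B)) = card (insert b A)"
        using B(1,2) insert.hyps(1) by simp
      show "\<forall>r\<in>insert c B. poly (pderiv p) r = 0 \<and> Min (insert b A) < r \<and> r < Max (insert b A)"
        unfolding mm
      proof
        fix r assume "r \<in> insert c B"
        then show "poly (pderiv p) r = 0 \<and> Min A < r \<and> r < b"
        proof
          assume [simp]: "r = c"
          have "Min A < c" using mA(3) c(1) by linarith
          with c0 c(2) show ?thesis by simp
        next
          assume "r \<in> B" with B(3) have "poly (pderiv p) r = 0" "Min A < r" "r < Max A" by auto
          moreover from this mA(4) have "r < b" by linarith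
          ultimately show ?thesis by simp
        qed
      qed
    qed (use B in auto)
  qed
qed

text \<open>By the product rule, each differentiation of \<open>r ^ Suc m * q\<close> costs at most
  one factor \<open>r\<close>.\<close>

lemma pderiv_iter_power_dvd:
  fixes r :: "'a :: idom poly"
  assumes "k \<le> n"
  shows "r ^ (n - k) dvd (pderiv ^^ k) (r ^ n)"
  using assms
proof (induction k)
  case (Suc k)
  then obtain q where q: "(pderiv ^^ k) (r ^ n) = r ^ Suc (n - Suc k) * q"
    by (metis dvd_def Suc_diff_Suc Suc_le_lessD Suc_leD)
  have "pderiv (r ^ Suc m * q) =
      r ^ m * (Polynomial.smult (of_nat (Suc m)) (pderiv r) * q + r * pderiv q)" for m
    by (simp only: pderiv_mult pderiv_power_Suc) (simp add: algebra_simps smult_add_left)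
  with q[symmetric] have "(pderiv ^^ Suc k) (r ^ n) = r ^ (n - Suc k) *
      (Polynomial.smult (of_nat (Suc (n - Suc k))) (pderiv r) * q + r * pderiv q)"
    by (metis funpow_simps_right(2) funpow_swap1 o_apply)
  then show ?case by (metis dvd_triv_left)
qed simp

lemma degree_legendre: "Polynomial.degree (legendre n) = n"
  by (simp add: legendre_def degree_higher_pderiv degree_power_eq)

text \<open>Rodrigues' formula and repeated Rolle: for \<open>k < n\<close> the \<open>k\<close>-th
  derivative of \<open>(t^2 - 1)^n\<close> still vanishes at -1 and 1. These ends and its
  \<open>k\<close> interior roots are \<open>k + 2\<close> points, hence the next derivative has
  \<open>k + 1\<close> interior roots.\<close>

lemma legendre_roots:
  "\<exists>A. finite A \<and> card A = n \<and> (\<forall>r\<in>A. poly (legendre n) r = 0 \<and> -1 < r \<and> r < 1)"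
proof -
  let ?p = "[:-1, 0, 1:] ^ n :: real poly"
  have "\<exists>A. finite A \<and> card A = k \<and> (\<forall>r\<in>A. poly ((pderiv ^^ k) ?p) r = 0 \<and> -1 < r \<and> r < 1)"
    if "k \<le> n" for k
    using that
  proof (induction k)
    case (Suc k)
    then obtain A where A: "finite A" "card A = k"
      "\<forall>r\<in>A. poly ((pderiv ^^ k) ?p) r = 0 \<and> -1 < r \<and> r < 1" by auto
    have "[:-1, 0, 1:] dvd (pderiv ^^ k) ?p"
      using pderiv_iter_power_dvd[of k n "[:-1, 0, 1:] :: real poly"] Suc.prems
      by (metis Suc_leD Suc_le_lessD dvd_power dvd_trans zero_less_diff)
    then have ends: "poly ((pderiv ^^ k) ?p) (-1) = 0" "poly ((pderiv ^^ k) ?p) 1 = 0"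
      by (auto simp: dvd_def)
    let ?A = "insert (-1) (insert 1 A)"
    have cd: "card ?A = Suc (Suc k)"
      using A by (subst card_insert_disjoint; force)
    have mm: "Min ?A = -1" "Max ?A = 1"
      using A by (intro Min_eqI Max_eqI; force)+
    show ?case
      using Rolle_poly_roots[of ?A "(pderiv ^^ k) ?p"] A ends unfolding cd mm by auto
  qed auto
  from this[of n] show ?thesis by (simp add: legendre_def)
qed

text \<open>Rolle between the \<open>n\<close> roots of the Legendre polynomial gives
  \<open>n - 1\<close> roots of its derivative inside (-1, 1). The derivative is nonzero of degree
  \<open>n - 1\<close>, so there are no others.\<close>

lemma gll_set:
  assumes "n \<ge> 1"
  shows "\<exists>B. finite B \<and> Suc (card B) = n \<and> (\<forall>r\<in>B. -1 < r \<and> r < 1) \<and>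
    {\<xi>. (1 - \<xi>\<^sup>2) * poly (pderiv (legendre n)) \<xi> = 0} = insert (-1) (insert 1 B)"
proof -
  let ?L = "pderiv (legendre n)"
  obtain A where A: "finite A" "card A = n" "\<forall>r\<in>A. poly (legendre n) r = 0 \<and> -1 < r \<and> r < 1"
    using legendre_roots by blast
  with assms have "A \<noteq> {}" by auto
  with Rolle_poly_roots[of A "legendre n"] A obtain B where
    B: "finite B" "Suc (card B) = n" "\<forall>r\<in>B. poly ?L r = 0 \<and> Min A < r \<and> r < Max A"
    by auto
  have "Min A \<in> A" "Max A \<in> A" using A \<open>A \<noteq> {}\<close> by auto
  with A B have in1: "\<forall>r\<in>B. -1 < r \<and> r < 1" by fastforce
  have "?L \<noteq> 0" using assms by (simp add: pderiv_eq_0_iff degree_legendre)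
  then have "finite {r. poly ?L r = 0}" "card {r. poly ?L r = 0} \<le> card B"
    using poly_roots_finite[of ?L] card_poly_roots_bound[of ?L] B(2)
    by (auto simp: degree_pderiv degree_legendre)
  moreover have "B \<subseteq> {r. poly ?L r = 0}" using B by auto
  ultimately have "B = {r. poly ?L r = 0}" by (intro card_seteq) auto
  moreover have "1 - \<xi>\<^sup>2 = 0 \<longleftrightarrow> \<xi> = -1 \<or> \<xi> = 1" for \<xi> :: real
    by (metis power2_eq_1_iff right_minus_eq)
  ultimately have "{\<xi>. (1 - \<xi>\<^sup>2) * poly ?L \<xi> = 0} = insert (-1) (insert 1 B)" by auto
  with B in1 show ?thesis by blast
qed

lemma gll_nodes:
  assumes "n \<ge> 1"
  shows "length (gll_nodes n) = Suc n" "gll_nodes n ! 0 = -1" "gll_nodes n ! n = 1"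
    and "sorted_wrt (<) (gll_nodes n)"
proof -
  obtain B where B: "finite B" "Suc (card B) = n" "\<forall>r\<in>B. -1 < r \<and> r < 1"
    and Z: "{\<xi>. (1 - \<xi>\<^sup>2) * poly (pderiv (legendre n)) \<xi> = 0} = insert (-1) (insert 1 B)"
    using gll_set[OF assms] by auto
  let ?g = "gll_nodes n"
  have "card (insert (-1) (insert 1 B)) = Suc n"
    using B by (subst card_insert_disjoint; force)
  then show len: "length ?g = Suc n" unfolding gll_nodes_def Z by simp
  show sorted: "sorted_wrt (<) ?g"
    by (simp add: gll_nodes_def strict_sorted_list_of_set)
  have set: "set ?g = insert (-1) (insert 1 B)" unfolding gll_nodes_def Z using B(1) by (intro set_sorted_list_of_set) simp
  have bd: "-1 \<le> ?g ! i" "?g ! i \<le> 1" if "i \<le> n" for i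
  proof -
    have "?g ! i \<in> set ?g" using len that by (intro nth_mem) auto
    then show "-1 \<le> ?g ! i" "?g ! i \<le> 1" using B(3) set by force+
  qed
  have "-1 \<in> set ?g" "1 \<in> set ?g" using set by auto
  then obtain i j where ij: "i \<le> n" "?g ! i = -1" "j \<le> n" "?g ! j = 1"
    by (metis in_set_conv_nth len less_Suc_eq_le)
  show "?g ! 0 = -1"
    using sorted_wrt_nth_less[OF sorted, of 0 i] bd[of 0] ij len by (cases "i = 0") auto
  show "?g ! n = 1"
    using sorted_wrt_nth_less[OF sorted, of j n] bd[of n] ij len by (cases "j = n") auto
qed

section \<open>Local and global bases\<close>

text \<open>The degree bound matters: the antiderivative of a local polynomial of degree at most
  \<open>N - 1\<close> is again determined by its values at the \<open>N + 1\<close> nodes of the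
  element.\<close>

lemma poly_antiderivative:
  fixes p :: "'a :: field_char_0 poly"
  shows "\<exists>P. pderiv P = p \<and> Polynomial.degree P \<le> Suc (Polynomial.degree p)"
proof (intro exI conjI)
  let ?P = "\<Sum>i\<le>Polynomial.degree p. monom (Polynomial.coeff p i / of_nat (Suc i)) (Suc i)"
  have "pderiv ?P = (\<Sum>i\<le>Polynomial.degree p. monom (Polynomial.coeff p i) i)"
    by (simp add: higher_pderiv_sum[of 1, simplified] pderiv_monom del: of_nat_Suc)
  then show "pderiv ?P = p" by (simp only: poly_as_sum_of_monoms)
  show "Polynomial.degree ?P \<le> Suc (Polynomial.degree p)"
    by (intro degree_sum_le) (auto intro: order_trans[OF degree_monom_le])
qed

lemma poly_has_integral:
  fixes p :: "real poly"
  assumes "a \<le> b"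
  shows "(poly (pderiv p) has_integral (poly p b - poly p a)) {a..b}"
  using assms
  by (intro fundamental_theorem_of_calculus)
    (auto simp flip: has_real_derivative_iff_has_vector_derivative
          intro: DERIV_subset[OF poly_DERIV])

text \<open>With derivatives of Lagrange polynomials for \<open>g\<close>, the partial sums are the
  edge polynomials up to sign, and nodal values become nodal increments.\<close>

lemma Abel_summation_smult:
  fixes g :: "nat \<Rightarrow> 'a :: comm_ring_1 poly"
  shows "(\<Sum>m\<le>n. Polynomial.smult (a m) (g m)) =
    Polynomial.smult (a n) (\<Sum>m\<le>n. g m)
      - (\<Sum>j<n. Polynomial.smult (a (Suc j) - a j) (\<Sum>m\<le>j. g m))"
  by (induction n) (simp_all add: smult_add_right smult_diff_left algebra_simps)

section \<open>The mesh and its global nodes\<close>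

locale mesh =
  fixes x :: "nat \<Rightarrow> real" and K N :: nat
  assumes K: "K \<ge> 1" and N: "N \<ge> 1" and x_mono: "strict_mono_on {0..K} x"
begin

lemma breakpoint_less: "i < j \<Longrightarrow> j \<le> K \<Longrightarrow> x i < x j"
  using x_mono by (auto simp: strict_mono_on_def)

lemma breakpoint_le: "i \<le> j \<Longrightarrow> j \<le> K \<Longrightarrow> x i \<le> x j"
  using breakpoint_less[of i j] by (cases "i = j") auto

lemma node_local:
  assumes "j \<le> N"
  shows "node x N (k * N + j) = x k + (x (Suc k) - x k) * ((gll_nodes N ! j + 1) / 2)"
proof (cases "j = N")
  case True
  \<comment> \<open>The definition of \<open>node\<close> reads this index as position 0 of the next
    element. Both readings give \<open>x (Suc k)\<close>, since the reference nodes start at -1 and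
    end at 1.\<close>
  then have "(k * N + j) div N = Suc k" "(k * N + j) mod N = 0"
    using N by (auto simp: div_add1_eq)
  then show ?thesis unfolding node_def using True gll_nodes[OF N] by simp
next
  case False
  with assms have "(k * N + j) div N = k" "(k * N + j) mod N = j" using N by auto
  then show ?thesis unfolding node_def by simp
qed

lemma node_left: "node x N (k * N) = x k"
  using node_local[of 0 k] gll_nodes(2)[OF N] by simp

lemma node_right: "node x N (k * N + N) = x (Suc k)"
  using node_local[of N k] gll_nodes(3)[OF N] by simp

lemma node_less:
  assumes "k < K" "i < j" "j \<le> N"
  shows "node x N (k * N + i) < node x N (k * N + j)"
proof -
  have "gll_nodes N ! i < gll_nodes N ! j"
    using sorted_wrt_nth_less[OF gll_nodes(4)[OF N]] gll_nodes(1)[OF N] assms by simp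
  then show ?thesis
    using assms breakpoint_less[of k "Suc k"] by (simp add: node_local)
qed

lemma node_mem:
  assumes "k < K" "j \<le> N"
  shows "node x N (k * N + j) \<in> {x k..x (Suc k)}"
proof -
  have "node x N (k * N + 0) \<le> node x N (k * N + j)"
    using node_less[OF assms(1), of 0 j] assms by (cases "j = 0") auto
  moreover have "node x N (k * N + j) \<le> node x N (k * N + N)"
    using node_less[OF assms(1), of j N] assms by (cases "j = N") auto
  ultimately show ?thesis by (simp add: node_left node_right)
qed

lemma node_eq_iff:
  assumes "k < K" "i \<le> N" "j \<le> N"
  shows "node x N (k * N + i) = node x N (k * N + j) \<longleftrightarrow> i = j"
  using node_less[OF assms(1), of i j] node_less[OF assms(1), of j i] assms
  by (cases i j rule: linorder_cases) auto

section \<open>Lagrange and edge polynomials on one element\<close>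

lemma poly_lagrange_node:
  assumes "k < K" "j \<le> N" "m \<le> N"
  shows "poly (lagrange_poly x N k j) (node x N (k * N + m)) = (if j = m then 1 else 0)"
proof (cases "j = m")
  case True
  then show ?thesis
    using assms node_eq_iff[OF assms(1)]
    by (auto simp: lagrange_poly_def poly_prod divide_simps intro!: prod.neutral)
next
  case False
  then show ?thesis
    using assms unfolding lagrange_poly_def poly_prod
    by (auto simp: prod_zero_iff intro!: bexI[of _ m])
qed

lemma degree_lagrange: "j \<le> N \<Longrightarrow> Polynomial.degree (lagrange_poly x N k j) \<le> N"
proof -
  assume j: "j \<le> N"
  have "Polynomial.degree (Polynomial.smult c [:a, 1:]) \<le> 1" for c a :: real
    using degree_smult_le[of c "[:a, 1:]"] by simp
  then have "Polynomial.degree (lagrange_poly x N k j) \<le> (\<Sum>m\<in>{..N} - {j}. 1)"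
    unfolding lagrange_poly_def
    by (intro order_trans[OF degree_prod_sum_le] sum_mono) (simp_all del: degree_smult_eq)
  with j show ?thesis by simp
qed

text \<open>Both sides have degree at most \<open>N\<close> and agree at the \<open>N + 1\<close>
  distinct nodes of the element.\<close>

lemma lagrange_expansion:
  assumes "k < K" "Polynomial.degree p \<le> N"
  shows "(\<Sum>m\<le>N. Polynomial.smult (poly p (node x N (k * N + m))) (lagrange_poly x N k m)) = p"
    (is "?s = _")
proof (rule poly_eqI_degree)
  let ?A = "(\<lambda>m. node x N (k * N + m)) ` {..N}"
  have "card ?A = Suc N"
    using node_eq_iff[OF assms(1)] by (subst card_image) (auto simp: inj_on_def)
  moreover have "Polynomial.degree ?s \<le> N"
    by (intro degree_sum_le) (auto intro: order_trans[OF degree_smult_le] degree_lagrange)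
  ultimately show "Polynomial.degree p < card ?A" "Polynomial.degree ?s < card ?A"
    using assms by auto
  fix t assume "t \<in> ?A"
  then obtain j where j: "j \<le> N" "t = node x N (k * N + j)" by auto
  have "poly ?s t = (\<Sum>m\<le>N. poly p (node x N (k * N + m)) * (if m = j then 1 else 0))"
    unfolding poly_sum using assms j by (auto simp: poly_lagrange_node intro!: sum.cong)
  also have "\<dots> = poly p t" using j by (simp add: if_distrib cong: if_cong)
  finally show "poly ?s t = poly p t" .
qed

text \<open>The Lagrange polynomials sum to 1, so their derivatives sum to 0. Index \<open>N\<close>
  names no edge of the element; this value lets formulas for consecutive partial sums include the
  last node.\<close>

lemma edge_poly_last:
  assumes "k < K"
  shows "edge_poly x N k N = 0"
proof -
  have "(\<Sum>m\<le>N. lagrange_poly x N k m) = 1" using lagrange_expansion[OF assms, of 1] by simp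
  then have "pderiv (\<Sum>m\<le>N. lagrange_poly x N k m) = 0" by simp
  then show ?thesis by (simp add: edge_poly_def higher_pderiv_sum[of 1, simplified])
qed

lemma pderiv_lagrange:
  assumes "k < K" "m \<le> N"
  shows "pderiv (lagrange_poly x N k m) =
    (if 0 < m then edge_poly x N k (m - 1) else 0) - (if m < N then edge_poly x N k m else 0)"
proof -
  have "pderiv (lagrange_poly x N k m) =
    (if 0 < m then edge_poly x N k (m - 1) else 0) - edge_poly x N k m"
    by (cases m) (simp_all add: edge_poly_def)
  with assms edge_poly_last show ?thesis by (cases "m = N") auto
qed

text \<open>Summation by parts of the Lagrange expansion; the remaining end term carries the full
  sum of the derivatives, which is 0. If \<open>p\<close> is an antiderivative of \<open>f\<close>,
  the coefficients are the integrals of \<open>f\<close> over the nodal intervals.\<close>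

lemma edge_expansion:
  assumes "k < K" "Polynomial.degree p \<le> N"
  shows "pderiv p = (\<Sum>j<N. Polynomial.smult
    (poly p (node x N (k * N + Suc j)) - poly p (node x N (k * N + j))) (edge_poly x N k j))"
proof -
  have "pderiv p = pderiv (\<Sum>m\<le>N. Polynomial.smult (poly p (node x N (k * N + m))) (lagrange_poly x N k m))"
    using lagrange_expansion[OF assms] by simp
  also have "\<dots> = (\<Sum>m\<le>N. Polynomial.smult (poly p (node x N (k * N + m))) (pderiv (lagrange_poly x N k m)))"
    by (simp add: pderiv_smult higher_pderiv_sum[of 1, simplified])
  finally show ?thesis
    using edge_poly_last[OF assms(1)]
    by (simp add: Abel_summation_smult edge_poly_def sum_negf)
qed

section \<open>Global basis functions and their restrictions to elements\<close>

lemma element_of_eq: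
  assumes "k < K" "x k < t" "t \<le> x (Suc k)"
  shows "element_of x t = k"
  unfolding element_of_def
proof (rule Least_equality)
  fix j assume "t \<le> x (Suc j)"
  then show "k \<le> j" using assms breakpoint_le[of "Suc j" k] by (cases "k \<le> j") auto
qed fact

lemma element_of_0: "element_of x (x 0) = 0"
  unfolding element_of_def using breakpoint_le[of 0 1] K by (intro Least_equality) auto

text \<open>The polynomial to which the \<open>i\<close>-th nodal function restricts on element
  \<open>k\<close>. Adjacent elements share the index of their common node, whereas the index ranges
  in \<open>local1\<close> are disjoint.\<close>

definition local0 :: "nat \<Rightarrow> nat \<Rightarrow> real poly" where
  "local0 k i = (if k * N \<le> i \<and> i \<le> k * N + N then lagrange_poly x N k (i - k * N) else 0)"

definition local1 :: "nat \<Rightarrow> nat \<Rightarrow> real poly" where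
  "local1 k i = (if k * N \<le> i \<and> i < k * N + N then edge_poly x N k (i - k * N) else 0)"

lemma local0_node:
  assumes "k < K" "m \<le> N"
  shows "poly (local0 k i) (node x N (k * N + m)) = (if i = k * N + m then 1 else 0)"
  using assms by (auto simp: local0_def poly_lagrange_node)

lemma element_subset: "k < K \<Longrightarrow> {x k..x (Suc k)} \<subseteq> {x 0..x K}"
  using breakpoint_le[of 0 k] breakpoint_le[of "Suc k" K] by auto

lemma basis0_local:
  assumes "k < K" "t \<in> {x k..x (Suc k)}"
  shows "basis0 x K N i t = poly (local0 k i) t"
proof -
  have t: "t \<in> {x 0..x K}" using assms element_subset by blast
  txt \<open>At a breakpoint the basis function is evaluated on the left element, but the Lagrange
    polynomials of both adjacent elements take the same value there.\<close>
  consider "x k < t" | "t = x k" "k = 0" | l where "t = x k" "k = Suc l" using assms by (cases k) force+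
  then show ?thesis
  proof cases
    case 1
    with assms have "element_of x t = k" by (intro element_of_eq) auto
    with t show ?thesis by (simp add: basis0_def local0_def Let_def add.commute)
  next
    case 2
    with t show ?thesis by (simp add: basis0_def local0_def Let_def element_of_0)
  next
    case 3
    then have "element_of x t = l"
      using assms breakpoint_less[of l "Suc l"] by (intro element_of_eq) auto
    with t have "basis0 x K N i t = poly (local0 l i) (node x N (l * N + N))"
      using 3 node_right[of l] by (simp add: basis0_def local0_def Let_def add.commute)
    also have "\<dots> = poly (local0 k i) (node x N (k * N + 0))"
      using assms 3 local0_node[of l N i] local0_node[of k 0 i] by (simp add: add.commute)
    finally show ?thesis using 3 node_left[of k] by simp
  qed
qed

lemma basis1_local:
  assumes "k < K" "t \<in> {x k<..<x (Suc k)}"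
  shows "basis1 x K N i t = poly (local1 k i) t"
proof -
  have t: "t \<in> {x 0..x K}" using assms element_subset[of k] by fastforce
  have "element_of x t = k" using assms by (intro element_of_eq) auto
  with t show ?thesis by (simp add: basis1_def local1_def Let_def add.commute)
qed

lemma nodeE:
  assumes "i < N * K + 1"
  obtains k m where "k < K" "m \<le> N" "i = k * N + m"
proof (cases "i = N * K")
  case True
  \<comment> \<open>Division by \<open>N\<close> would assign the last node to an element
    \<open>K\<close>, which lies beyond the mesh; it is taken as the right end of element
    \<open>K - 1\<close>.\<close>
  then have "i = (K - 1) * N + N" using K by (cases K) auto
  with K that[of "K - 1" N] show ?thesis by simp
next
  case False
  then have "i div N < K" using assms N by (simp add: less_mult_imp_div_less mult.commute)
  moreover have "i mod N \<le> N" using N by (simp add: less_imp_le)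
  moreover have "i = i div N * N + i mod N" by simp
  ultimately show ?thesis using that by blast
qed

lemma node_in: "i < N * K + 1 \<Longrightarrow> node x N i \<in> {x 0..x K}"
  by (metis nodeE node_mem element_subset subsetD)

lemma basis0_node:
  assumes "j < N * K + 1"
  shows "basis0 x K N i (node x N j) = (if i = j then 1 else 0)"
proof -
  obtain k m where "k < K" "m \<le> N" "j = k * N + m" using nodeE[OF assms] .
  then show ?thesis using basis0_local[OF \<open>k < K\<close> node_mem] local0_node by simp
qed

lemma elementE:
  assumes "t \<in> {x 0..x K}"
  obtains k where "k < K" "t \<in> {x k..x (Suc k)}"
proof -
  \<comment> \<open>Generalized from \<open>K\<close> to every initial segment of the mesh: either
    \<open>t\<close> lies in the last element of the segment, or the shorter segment already
    contains it.\<close>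
  have "t \<le> x n \<Longrightarrow> 0 < n \<Longrightarrow> \<exists>k<n. t \<in> {x k..x (Suc k)}" for n
  proof (induction n)
    case (Suc n)
    show ?case
    proof (cases "n = 0 \<or> x n < t")
      case True
      then show ?thesis using Suc.prems assms by (auto intro!: exI[of _ n])
    next
      case False
      then have "t \<le> x n" "0 < n" by auto
      from Suc.IH[OF this] show ?thesis using less_SucI by blast
    qed
  qed simp
  with assms K that show ?thesis by force
qed

text \<open>Continuity comes for free: the local polynomials describe \<open>q\<close> on closed
  elements, breakpoints included, and finitely many closed sets can be pasted.\<close>

lemma G_spaceI:
  assumes "q \<in> extensional {x 0..x K}"
    and "\<And>k. k < K \<Longrightarrow> \<exists>p. Polynomial.degree p \<le> N \<and> (\<forall>t\<in>{x k..x (Suc k)}. q t = poly p t)"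
  shows "q \<in> G_space x K N"
proof -
  have "continuous_on (\<Union>k\<in>{..<K}. {x k..x (Suc k)}) q"
  proof (rule continuous_on_closed_Union)
    fix k assume "k \<in> {..<K}"
    then obtain p where "\<forall>t\<in>{x k..x (Suc k)}. q t = poly p t" using assms(2) by auto
    then show "continuous_on {x k..x (Suc k)} q"
      by (subst continuous_on_cong[OF refl]) (auto intro: continuous_intros)
  qed auto
  moreover have "(\<Union>k\<in>{..<K}. {x k..x (Suc k)}) = {x 0..x K}"
    using element_subset by (blast elim: elementE)
  ultimately show ?thesis using assms by (simp add: G_space_def)
qed

lemma sum_local0:
  assumes "k < K"
  shows "(\<Sum>i<N * K + 1. c i * poly (local0 k i) t) =
    (\<Sum>m\<le>N. c (k * N + m) * poly (lagrange_poly x N k m) t)"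
proof -
  have "Suc k * N \<le> K * N" using assms by (intro mult_le_mono) auto
  then have le: "k * N + N \<le> N * K" by (simp add: algebra_simps)
  have "(\<Sum>i<N * K + 1. c i * poly (local0 k i) t) =
      (\<Sum>i\<in>{k * N..k * N + N}. c i * poly (local0 k i) t)"
    using le by (intro sum.mono_neutral_right) (auto simp: local0_def)
  also have "\<dots> = (\<Sum>m\<le>N. c (k * N + m) * poly (lagrange_poly x N k m) t)"
    by (rule sum.reindex_bij_witness[of _ "\<lambda>m. k * N + m" "\<lambda>i. i - k * N"])
      (auto simp: local0_def)
  finally show ?thesis .
qed

lemma sum_local1:
  assumes "k < K"
  shows "(\<Sum>i<N * K. c i * poly (local1 k i) t) =
    (\<Sum>m<N. c (k * N + m) * poly (edge_poly x N k m) t)"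
proof -
  have "Suc k * N \<le> K * N" using assms by (intro mult_le_mono) auto
  then have le: "k * N + N \<le> N * K" by (simp add: algebra_simps)
  have "(\<Sum>i<N * K. c i * poly (local1 k i) t) =
      (\<Sum>i\<in>{k * N..<k * N + N}. c i * poly (local1 k i) t)"
    using le by (intro sum.mono_neutral_right) (auto simp: local1_def)
  also have "\<dots> = (\<Sum>m<N. c (k * N + m) * poly (edge_poly x N k m) t)"
    by (rule sum.reindex_bij_witness[of _ "\<lambda>m. k * N + m" "\<lambda>i. i - k * N"])
      (auto simp: local1_def)
  finally show ?thesis .
qed

lemma pderiv_local0:
  assumes "k < K"
  shows "pderiv (local0 k i) =
    (if 0 < i then local1 k (i - 1) else 0) - (if i < N * K then local1 k i else 0)"
proof -
  have "Suc k * N \<le> K * N" using assms by (intro mult_le_mono) auto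
  then have le: "k * N + N \<le> N * K" by (simp add: algebra_simps)
  \<comment> \<open>At the left end node of element \<open>k\<close>, the preceding edge belongs to
    the previous element. For \<open>i = 0\<close> truncated subtraction would give edge 0 instead,
    hence the guard.\<close>
  have first: "local1 k (i - 1) = 0" if "i = k * N" "0 < i"
  proof -
    have "\<not> k * N \<le> i - 1" using that by linarith
    then show ?thesis unfolding local1_def by simp
  qed
  consider "i < k * N" | "i = k * N" | "k * N < i" "i \<le> k * N + N" | "k * N + N < i" by linarith
  then show ?thesis
  proof cases
    case 2
    then have "pderiv (local0 k i) = - local1 k i" "i < N * K"
      using assms N le by (simp_all add: local0_def local1_def pderiv_lagrange)
    with first[OF 2] show ?thesis by simp
  qed (use assms N le in \<open>auto simp: local0_def local1_def pderiv_lagrange\<close>)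
qed

lemma G_space_expansion:
  assumes "q \<in> G_space x K N" "t \<in> {x 0..x K}"
  shows "q t = (\<Sum>i<N * K + 1. q (node x N i) * basis0 x K N i t)"
proof -
  obtain k where k: "k < K" "t \<in> {x k..x (Suc k)}" using elementE[OF assms(2)] .
  with assms obtain p where p: "Polynomial.degree p \<le> N" "\<forall>t\<in>{x k..x (Suc k)}. q t = poly p t"
    by (auto simp: G_space_def)
  have "(\<Sum>i<N * K + 1. q (node x N i) * basis0 x K N i t) =
      (\<Sum>m\<le>N. poly p (node x N (k * N + m)) * poly (lagrange_poly x N k m) t)"
    using p(2) node_mem[OF k(1)] by (simp only: basis0_local[OF k] sum_local0[OF k(1)]) simp
  also have "\<dots> = poly p t"
    using arg_cong[OF lagrange_expansion[OF k(1) p(1)], of "\<lambda>p. poly p t"] by (simp add: poly_sum)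
  finally show ?thesis using p k by simp
qed

text \<open>On one element, take an antiderivative \<open>P\<close> of the local polynomial. By the
  fundamental theorem its nodal increments are the degrees of freedom of \<open>f\<close>, and
  \<open>edge_expansion\<close> applied to \<open>P\<close> recovers \<open>f\<close>.\<close>

lemma S_space_expansion:
  assumes "f \<in> S_space x K N" "k < K" "t \<in> {x k<..<x (Suc k)}"
  shows "f t = (\<Sum>i<N * K. vec_index (dof1 x K N f) i * basis1 x K N i t)"
proof -
  from assms obtain p where p: "Polynomial.degree p \<le> N - 1" "\<forall>t\<in>{x k<..<x (Suc k)}. f t = poly p t"
    by (auto simp: S_space_def)
  obtain P where P: "pderiv P = p" "Polynomial.degree P \<le> Suc (Polynomial.degree p)"
    using poly_antiderivative by blast
  then have degP: "Polynomial.degree P \<le> N" using p N by simp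
  have "integral {node x N (k * N + m)..node x N (Suc (k * N + m))} f =
      poly P (node x N (k * N + Suc m)) - poly P (node x N (k * N + m))" if "m < N" for m
  proof -
    have "(poly p has_integral
        (poly P (node x N (k * N + Suc m)) - poly P (node x N (k * N + m))))
      {node x N (k * N + m)..node x N (k * N + Suc m)}"
      using poly_has_integral[of _ _ P] node_less[OF assms(2), of m "Suc m"] that P(1) by simp
    then have "(f has_integral
        (poly P (node x N (k * N + Suc m)) - poly P (node x N (k * N + m))))
      {node x N (k * N + m)..node x N (k * N + Suc m)}"
    proof (rule has_integral_spike_finite[rotated 2])
      \<comment> \<open>The first or last nodal interval may touch a breakpoint, where the value of
        \<open>f\<close> is arbitrary.\<close>
      show "finite {x k, x (Suc k)}" by simp
      fix t assume "t \<in> {node x N (k * N + m)..node x N (k * N + Suc m)} - {x k, x (Suc k)}"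
      then have "t \<in> {x k<..<x (Suc k)}"
        using node_mem[OF assms(2), of m] node_mem[OF assms(2), of "Suc m"] that by auto
      with p(2) show "f t = poly p t" by blast
    qed
    then show ?thesis by (simp add: integral_unique)
  qed
  moreover have "k * N + m < N * K" if "m < N" for m
  proof -
    have "Suc k * N \<le> K * N" using assms by (intro mult_le_mono) auto
    with that show ?thesis by (simp add: algebra_simps)
  qed
  ultimately have "(\<Sum>i<N * K. vec_index (dof1 x K N f) i * basis1 x K N i t) =
      (\<Sum>m<N. (poly P (node x N (k * N + Suc m)) - poly P (node x N (k * N + m)))
        * poly (edge_poly x N k m) t)"
    by (simp only: basis1_local[OF assms(2,3)] sum_local1[OF assms(2)]) (simp add: dof1_def)
  also have "\<dots> = poly p t"
    by (subst P(1)[symmetric], subst edge_expansion[OF assms(2) degP]) (simp add: poly_sum)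
  finally show ?thesis using p assms by simp
qed

subsection \<open>Integrals of piecewise polynomials\<close>

text \<open>Open elements and no degree bound, so that representatives of S(I), derivatives of nodal
  functions and all products qualify. It serves to supply integrability.\<close>

definition piecewise_poly :: "(real \<Rightarrow> real) \<Rightarrow> bool" where
  "piecewise_poly f \<longleftrightarrow> (\<forall>k<K. \<exists>p. \<forall>t\<in>{x k<..<x (Suc k)}. f t = poly p t)"

lemma piecewise_polyD:
  assumes "piecewise_poly f" "k < K"
  obtains p where "\<And>t. t \<in> {x k<..<x (Suc k)} \<Longrightarrow> f t = poly p t"
  using assms unfolding piecewise_poly_def by blast

lemma piecewise_poly_mult:
  assumes "piecewise_poly f" "piecewise_poly g"
  shows "piecewise_poly (\<lambda>t. f t * g t)"
  unfolding piecewise_poly_def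
proof (intro allI impI)
  fix k assume k: "k < K"
  obtain p q where "\<And>t. t \<in> {x k<..<x (Suc k)} \<Longrightarrow> f t = poly p t"
    "\<And>t. t \<in> {x k<..<x (Suc k)} \<Longrightarrow> g t = poly q t"
    using piecewise_polyD[OF assms(1) k] piecewise_polyD[OF assms(2) k] by metis
  then show "\<exists>r. \<forall>t\<in>{x k<..<x (Suc k)}. f t * g t = poly r t"
    by (intro exI[of _ "p * q"]) simp
qed

lemma piecewise_poly_uminus:
  assumes "piecewise_poly f"
  shows "piecewise_poly (\<lambda>t. - f t)"
  unfolding piecewise_poly_def
proof (intro allI impI)
  fix k assume k: "k < K"
  obtain p where "\<And>t. t \<in> {x k<..<x (Suc k)} \<Longrightarrow> f t = poly p t"
    using piecewise_polyD[OF assms k] by metis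
  then show "\<exists>r. \<forall>t\<in>{x k<..<x (Suc k)}. - f t = poly r t"
    by (intro exI[of _ "- p"]) simp
qed

lemma piecewise_poly_basis0: "piecewise_poly (basis0 x K N i)"
  unfolding piecewise_poly_def using basis0_local by fastforce

lemma piecewise_poly_basis1: "piecewise_poly (basis1 x K N i)"
  unfolding piecewise_poly_def using basis1_local by fastforce

lemma piecewise_poly_S: "f \<in> S_space x K N \<Longrightarrow> piecewise_poly f"
  unfolding piecewise_poly_def S_space_def by blast

lemma piecewise_poly_G:
  assumes "q \<in> G_space x K N"
  shows "piecewise_poly q"
  unfolding piecewise_poly_def
proof (intro allI impI)
  fix k assume "k < K"
  with assms obtain p where "\<forall>t\<in>{x k..x (Suc k)}. q t = poly p t"
    unfolding G_space_def by blast
  then show "\<exists>p. \<forall>t\<in>{x k<..<x (Suc k)}. q t = poly p t" by (intro exI[of _ p]) simp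
qed

lemma interior_elementE:
  assumes "t \<in> {x 0..x K} - x ` {..K}"
  obtains k where "k < K" "t \<in> {x k<..<x (Suc k)}"
proof -
  obtain k where k: "k < K" "t \<in> {x k..x (Suc k)}" using elementE assms by blast
  moreover have "x k \<in> x ` {..K}" "x (Suc k) \<in> x ` {..K}" using k by auto
  with assms have "t \<noteq> x k" "t \<noteq> x (Suc k)" by auto
  ultimately show ?thesis using that[of k] by simp
qed

text \<open>The finitely many breakpoints form a null set.\<close>

lemma integral_cong_elements:
  fixes f g :: "real \<Rightarrow> real"
  assumes "\<And>k t. k < K \<Longrightarrow> t \<in> {x k<..<x (Suc k)} \<Longrightarrow> f t = g t"
  shows "integral {x 0..x K} f = integral {x 0..x K} g"
proof (rule integral_spike)
  show "negligible (x ` {..K})" by (intro negligible_finite) simp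
  show "g t = f t" if "t \<in> {x 0..x K} - x ` {..K}" for t
    using interior_elementE[OF that] assms by metis
qed

text \<open>Elements are joined from left to right; on each one the function differs from a
  polynomial at most at the two ends.\<close>

lemma piecewise_poly_integrable:
  assumes "piecewise_poly f"
  shows "f integrable_on {x 0..x K}"
proof -
  have "n \<le> K \<Longrightarrow> f integrable_on {x 0..x n}" for n
  proof (induction n)
    case (Suc n)
    then have n: "n < K" by simp
    obtain p where p: "\<And>t. t \<in> {x n<..<x (Suc n)} \<Longrightarrow> f t = poly p t"
      using piecewise_polyD[OF assms n] by metis
    have "poly p integrable_on {x n..x (Suc n)}"
      by (intro integrable_continuous_real continuous_intros)
    then have "f integrable_on {x n..x (Suc n)}"
      by (rule integrable_spike_finite[rotated 2, of _ _ "{x n, x (Suc n)}"]) (use p in auto)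
    moreover have "f integrable_on {x 0..x n}" using Suc by simp
    moreover have "x 0 \<le> x n" "x n \<le> x (Suc n)" using n by (auto intro: breakpoint_le)
    ultimately show ?case using Henstock_Kurzweil_Integration.integrable_combine by blast
  qed (use integrable_on_refl[of f "x 0"] in simp)
  then show ?thesis by simp
qed

lemma basis0_in_G: "basis0 x K N i \<in> G_space x K N"
proof (rule G_spaceI)
  show "basis0 x K N i \<in> extensional {x 0..x K}" by (simp add: basis0_def)
  fix k assume "k < K"
  then show "\<exists>p. Polynomial.degree p \<le> N \<and> (\<forall>t\<in>{x k..x (Suc k)}. basis0 x K N i t = poly p t)"
    using basis0_local
    by (intro exI[of _ "local0 k i"]) (auto simp: local0_def degree_lagrange)
qed

text \<open>Builds the member of G(I) with nodal values \<open>c\<close>. The restriction to the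
  mesh interval makes it extensional, so that \<open>G_space_eq_combination0\<close> is an equality
  of functions.\<close>

definition combination0 :: "(nat \<Rightarrow> real) \<Rightarrow> real \<Rightarrow> real" where
  "combination0 c = (\<lambda>t\<in>{x 0..x K}. \<Sum>i<N * K + 1. c i * basis0 x K N i t)"

lemma combination0_in_G: "combination0 c \<in> G_space x K N"
proof (rule G_spaceI)
  show "combination0 c \<in> extensional {x 0..x K}" by (simp add: combination0_def)
  fix k assume k: "k < K"
  let ?p = "\<Sum>i<N * K + 1. Polynomial.smult (c i) (local0 k i)"
  have "Polynomial.degree ?p \<le> N"
    by (intro degree_sum_le)
      (auto intro!: order_trans[OF degree_smult_le] simp: local0_def degree_lagrange)
  moreover have "combination0 c t = poly ?p t" if "t \<in> {x k..x (Suc k)}" for t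
    using that element_subset[OF k] basis0_local[OF k that]
    by (simp add: combination0_def poly_sum subset_iff)
  ultimately show "\<exists>p. Polynomial.degree p \<le> N \<and> (\<forall>t\<in>{x k..x (Suc k)}. combination0 c t = poly p t)"
    by blast
qed

lemma combination0_node: "j < N * K + 1 \<Longrightarrow> combination0 c (node x N j) = c j"
  using node_in[of j] by (simp add: combination0_def basis0_node if_distrib cong: if_cong)

lemma G_space_eq_combination0:
  assumes "q \<in> G_space x K N"
  shows "q = combination0 (\<lambda>i. q (node x N i))"
proof (rule extensionalityI)
  show "q \<in> extensional {x 0..x K}" using assms by (simp add: G_space_def)
  show "combination0 (\<lambda>i. q (node x N i)) \<in> extensional {x 0..x K}"
    by (simp add: combination0_def)
  show "q t = combination0 (\<lambda>i. q (node x N i)) t" if "t \<in> {x 0..x K}" for t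
    using G_space_expansion[OF assms that] that by (simp add: combination0_def)
qed

section \<open>Derivatives inside the elements\<close>

lemma basis0_has_derivative:
  assumes "k < K" "t \<in> {x k<..<x (Suc k)}"
  shows "(basis0 x K N i has_real_derivative
    (if 0 < i then basis1 x K N (i - 1) t else 0) - (if i < N * K then basis1 x K N i t else 0)) (at t)"
proof -
  have "(basis0 x K N i has_real_derivative poly (pderiv (local0 k i)) t) (at t)"
    by (rule has_field_derivative_transform_within_open[OF poly_DERIV, of "{x k<..<x (Suc k)}"])
      (use assms basis0_local[OF assms(1)] in auto)
  moreover have "poly (pderiv (local0 k i)) t =
    (if 0 < i then basis1 x K N (i - 1) t else 0) - (if i < N * K then basis1 x K N i t else 0)"
    using basis1_local[OF assms] by (simp add: pderiv_local0[OF assms(1)])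
  ultimately show ?thesis by (simp only:)
qed

lemma deriv_basis0:
  assumes "k < K" "t \<in> {x k<..<x (Suc k)}"
  shows "deriv (basis0 x K N i) t =
    (if 0 < i then basis1 x K N (i - 1) t else 0) - (if i < N * K then basis1 x K N i t else 0)"
  using basis0_has_derivative[OF assms] by (rule DERIV_imp_deriv)

lemma piecewise_poly_deriv_basis0: "piecewise_poly (deriv (basis0 x K N i))"
  unfolding piecewise_poly_def
proof (intro allI impI)
  fix k assume k: "k < K"
  have "deriv (basis0 x K N i) t = poly (pderiv (local0 k i)) t" if "t \<in> {x k<..<x (Suc k)}" for t
    using deriv_basis0[OF k that] basis1_local[OF k that] by (simp add: pderiv_local0[OF k])
  then show "\<exists>p. \<forall>t\<in>{x k<..<x (Suc k)}. deriv (basis0 x K N i) t = poly p t" by blast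
qed

lemma deriv_combination0:
  assumes "k < K" "t \<in> {x k<..<x (Suc k)}"
  shows "deriv (combination0 c) t = (\<Sum>i<N * K + 1. c i * deriv (basis0 x K N i) t)"
proof (rule DERIV_imp_deriv)
  have "((\<lambda>t. \<Sum>i<N * K + 1. c i * basis0 x K N i t) has_real_derivative
      (\<Sum>i<N * K + 1. c i * deriv (basis0 x K N i) t)) (at t)"
    unfolding deriv_basis0[OF assms]
    by (intro DERIV_sum DERIV_cmult basis0_has_derivative[OF assms])
  then show "(combination0 c has_real_derivative
      (\<Sum>i<N * K + 1. c i * deriv (basis0 x K N i) t)) (at t)"
  proof (rule has_field_derivative_transform_within_open)
    show "(\<Sum>i<N * K + 1. c i * basis0 x K N i s) = combination0 c s"
      if "s \<in> {x k<..<x (Suc k)}" for s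
      using that element_subset[OF assms(1)] by (auto simp: combination0_def subset_iff)
  qed (use assms in auto)
qed

lemma integral_mult_combination0:
  assumes "piecewise_poly f"
  shows "integral {x 0..x K} (\<lambda>t. f t * combination0 c t) =
    (\<Sum>i<N * K + 1. c i * integral {x 0..x K} (\<lambda>t. f t * basis0 x K N i t))"
proof -
  have "integral {x 0..x K} (\<lambda>t. f t * combination0 c t) =
      integral {x 0..x K} (\<lambda>t. \<Sum>i<N * K + 1. c i * (f t * basis0 x K N i t))"
    by (intro integral_cong) (simp add: combination0_def sum_distrib_left algebra_simps)
  also have "\<dots> = (\<Sum>i<N * K + 1. integral {x 0..x K} (\<lambda>t. c i * (f t * basis0 x K N i t)))"
    by (intro integral_sum finite_lessThan integrable_on_mult_right piecewise_poly_integrable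
        piecewise_poly_mult assms piecewise_poly_basis0)
  finally show ?thesis by simp
qed

section \<open>Dual degrees of freedom as moments, and invertibility of the mass matrix\<close>

lemma dual_dof1_index:
  assumes "q \<in> G_space x K N" "i < N * K + 1"
  shows "vec_index (dual_dof1 x K N q) i = integral {x 0..x K} (\<lambda>t. basis0 x K N i t * q t)"
proof -
  have "vec_index (dual_dof1 x K N q) i = (\<Sum>j<N * K + 1.
      q (node x N j) * integral {x 0..x K} (\<lambda>t. basis0 x K N i t * basis0 x K N j t))"
    using assms(2) by (simp add: dual_dof1_def mass0_def dof0_def scalar_prod_def
        lessThan_atLeast0 mult.commute)
  \<comment> \<open>Only the \<open>q\<close> under the integral is expanded; the nodal values on
    the left are the coefficients of that expansion.\<close>
  also have "\<dots> = integral {x 0..x K} (\<lambda>t. basis0 x K N i t * q t)"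
    by (subst (2) G_space_eq_combination0[OF assms(1)])
      (rule integral_mult_combination0[symmetric, OF piecewise_poly_basis0])
  finally show ?thesis .
qed

text \<open>As for G(I), but the edge expansion of \<open>f\<close> is available only inside the
  elements, which suffices under the integral.\<close>

lemma dual_dof0_index:
  assumes "f \<in> S_space x K N" "i < N * K"
  shows "vec_index (dual_dof0 x K N f) i = integral {x 0..x K} (\<lambda>t. basis1 x K N i t * f t)"
proof -
  let ?c = "vec_index (dof1 x K N f)"
  have "integral {x 0..x K} (\<lambda>t. basis1 x K N i t * f t) =
      integral {x 0..x K} (\<lambda>t. \<Sum>j<N * K. ?c j * (basis1 x K N i t * basis1 x K N j t))"
  proof (rule integral_cong_elements)
    fix k t assume "k < K" "t \<in> {x k<..<x (Suc k)}"
    from S_space_expansion[OF assms(1) this]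
    show "basis1 x K N i t * f t =
        (\<Sum>j<N * K. ?c j * (basis1 x K N i t * basis1 x K N j t))"
      by (simp add: sum_distrib_left algebra_simps)
  qed
  also have "\<dots> = (\<Sum>j<N * K. integral {x 0..x K}
      (\<lambda>t. ?c j * (basis1 x K N i t * basis1 x K N j t)))"
    by (intro integral_sum finite_lessThan integrable_on_mult_right piecewise_poly_integrable
        piecewise_poly_mult piecewise_poly_basis1)
  also have "\<dots> = vec_index (dual_dof0 x K N f) i"
    using assms(2) by (simp add: dual_dof0_def mass1_def dof1_def scalar_prod_def
        lessThan_atLeast0 mult.commute)
  finally show ?thesis by simp
qed

lemma mass0_carrier: "mass0 x K N \<in> carrier_mat (N * K + 1) (N * K + 1)"
  by (simp add: mass0_def)

text \<open>The quadratic form of the mass matrix is the squared \<open>L\<^sup>2\<close> norm on \<open>G(I)\<close>.\<close>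

lemma det_mass0: "det (mass0 x K N) \<noteq> 0"
proof
  assume "det (mass0 x K N) = 0"
  then obtain v where v: "v \<in> carrier_vec (N * K + 1)" "v \<noteq> 0\<^sub>v (N * K + 1)"
      "mass0 x K N *\<^sub>v v = 0\<^sub>v (N * K + 1)"
    using det_0_iff_vec_prod_zero_field[OF mass0_carrier] by blast
  \<comment> \<open>A kernel vector, read as nodal values, gives a function orthogonal to all nodal
    functions and hence to itself. Continuity then makes it vanish everywhere, in particular at the
    nodes.\<close>
  define d where "d = combination0 (vec_index v)"
  have d: "d \<in> G_space x K N" unfolding d_def by (rule combination0_in_G)
  have "dof0 x K N d = v"
    using v(1) by (intro eq_vecI) (auto simp: dof0_def d_def combination0_node)
  then have "dual_dof1 x K N d = 0\<^sub>v (N * K + 1)" using v(3) by (simp add: dual_dof1_def)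
  then have "integral {x 0..x K} (\<lambda>t. basis0 x K N i t * d t) = 0" if "i < N * K + 1" for i
    using dual_dof1_index[OF d that] that by simp
  then have "integral {x 0..x K} (\<lambda>t. d t * d t) = 0"
    unfolding d_def
    by (subst integral_mult_combination0[OF piecewise_poly_G[OF combination0_in_G]])
      (simp add: mult.commute)
  moreover have "continuous_on {x 0..x K} (\<lambda>t. d t * d t)"
    using d by (intro continuous_intros) (auto simp: G_space_def)
  ultimately have d0: "\<forall>t\<in>{x 0..x K}. d t * d t = 0"
    using integral_eq_0_iff[of "x 0" "x K" "\<lambda>t. d t * d t"] breakpoint_less[of 0 K] K by simp
  have "v = 0\<^sub>v (N * K + 1)"
  proof (intro eq_vecI)
    fix i assume "i < dim_vec (0\<^sub>v (N * K + 1) :: real vec)"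
    then have i: "i < N * K + 1" by simp
    have "vec_index v i = d (node x N i)" using i by (simp add: d_def combination0_node)
    also have "\<dots> = 0" using d0 node_in[OF i] by simp
    finally show "vec_index v i = vec_index (0\<^sub>v (N * K + 1)) i" using i by simp
  qed (use v in simp)
  with v(2) show False by simp
qed

text \<open>The right inverse gives existence of a function with prescribed dual degrees of freedom,
  the left inverse its uniqueness. The value \<open>()\<close> fills the extension slot of the
  matrix ring record.\<close>

lemma mass0_inverse:
  obtains B where "B \<in> carrier_mat (N * K + 1) (N * K + 1)"
    "B * mass0 x K N = 1\<^sub>m (N * K + 1)" "mass0 x K N * B = 1\<^sub>m (N * K + 1)"
  using det_non_zero_imp_unit[OF mass0_carrier det_mass0, of "()"]
  by (auto simp: Units_def ring_mat_def)

lemma ex_dual_dof1: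
  assumes "r \<in> carrier_vec (N * K + 1)"
  shows "\<exists>q\<in>G_space x K N. dual_dof1 x K N q = r"
proof -
  obtain B where B: "B \<in> carrier_mat (N * K + 1) (N * K + 1)"
    "mass0 x K N * B = 1\<^sub>m (N * K + 1)" by (rule mass0_inverse)
  let ?q = "combination0 (vec_index (B *\<^sub>v r))"
  have "dof0 x K N ?q = B *\<^sub>v r"
    using B by (intro eq_vecI) (auto simp: dof0_def combination0_node)
  then have "dual_dof1 x K N ?q = mass0 x K N *\<^sub>v (B *\<^sub>v r)" by (simp add: dual_dof1_def)
  also have "\<dots> = r"
    using assoc_mult_mat_vec[OF mass0_carrier B(1) assms] B(2) assms by simp
  finally show ?thesis using combination0_in_G by blast
qed

lemma dual_dof1_inj:
  assumes "q \<in> G_space x K N" "q' \<in> G_space x K N" "dual_dof1 x K N q = dual_dof1 x K N q'"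
  shows "q = q'"
proof -
  obtain B where B: "B \<in> carrier_mat (N * K + 1) (N * K + 1)"
    "B * mass0 x K N = 1\<^sub>m (N * K + 1)" by (rule mass0_inverse)
  have c: "dof0 x K N u \<in> carrier_vec (N * K + 1)" for u by (simp add: dof0_def)
  have "B *\<^sub>v dual_dof1 x K N u = dof0 x K N u" for u
    by (simp only: dual_dof1_def assoc_mult_mat_vec[OF B(1) mass0_carrier c, symmetric] B(2)
        one_mult_mat_vec[OF c])
  with assms(3) have dof: "dof0 x K N q = dof0 x K N q'" by metis
  have "q (node x N i) = q' (node x N i)" if "i < N * K + 1" for i
    using arg_cong[OF dof, of "\<lambda>v. vec_index v i"] that by (simp add: dof0_def)
  then have "combination0 (\<lambda>i. q (node x N i)) = combination0 (\<lambda>i. q' (node x N i))"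
    by (simp add: combination0_def)
  with G_space_eq_combination0 assms show ?thesis by metis
qed

subsection \<open>The weak derivative\<close>

text \<open>The right-hand side of the weak form as a functional of the test function, whose
  linearity is shown next.\<close>

definition weak_rhs :: "(real \<Rightarrow> real) \<Rightarrow> real \<times> real \<Rightarrow> (real \<Rightarrow> real) \<Rightarrow> real" where
  "weak_rhs \<phi> bd q = integral {x 0..x K} (\<lambda>t. \<phi> t * (- deriv q t))
    + (snd bd * q (x K) - fst bd * q (x 0))"

lemma weak_rhs_combination0:
  assumes "piecewise_poly \<phi>"
  shows "weak_rhs \<phi> bd (combination0 c) = (\<Sum>i<N * K + 1. c i * weak_rhs \<phi> bd (basis0 x K N i))"
proof -
  have "integral {x 0..x K} (\<lambda>t. \<phi> t * (- deriv (combination0 c) t)) =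
      integral {x 0..x K} (\<lambda>t. \<Sum>i<N * K + 1. c i * (\<phi> t * (- deriv (basis0 x K N i) t)))"
    by (intro integral_cong_elements)
      (simp add: deriv_combination0 sum_distrib_left sum_negf algebra_simps)
  also have "\<dots> = (\<Sum>i<N * K + 1. integral {x 0..x K} (\<lambda>t. c i * (\<phi> t * (- deriv (basis0 x K N i) t))))"
    by (intro integral_sum finite_lessThan integrable_on_mult_right piecewise_poly_integrable
        piecewise_poly_mult assms piecewise_poly_uminus piecewise_poly_deriv_basis0)
  also have "\<dots> = (\<Sum>i<N * K + 1. c i * integral {x 0..x K} (\<lambda>t. \<phi> t * (- deriv (basis0 x K N i) t)))"
    by (simp del: mult_minus_right)
  finally have "integral {x 0..x K} (\<lambda>t. \<phi> t * (- deriv (combination0 c) t)) = \<dots>" .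
  moreover have "x 0 \<in> {x 0..x K}" "x K \<in> {x 0..x K}" using breakpoint_le[of 0 K] by auto
  then have "combination0 c (x 0) = (\<Sum>i<N * K + 1. c i * basis0 x K N i (x 0))"
    "combination0 c (x K) = (\<Sum>i<N * K + 1. c i * basis0 x K N i (x K))"
    by (simp_all add: combination0_def)
  ultimately show ?thesis
    unfolding weak_rhs_def
    by (simp only: sum_distrib_left sum.distrib[symmetric] sum_subtractf[symmetric])
      (simp add: algebra_simps)
qed

text \<open>Both sides of the weak form are linear in the test function, so testing with the nodal
  basis is enough; the left sides of those tests are the dual degrees of freedom.\<close>

lemma weak_form_iff_dual_dof1:
  assumes "piecewise_poly \<phi>" "\<psi> \<in> G_space x K N"
  shows "(\<forall>q\<in>G_space x K N. integral {x 0..x K} (\<lambda>t. \<psi> t * q t) = weak_rhs \<phi> bd q) \<longleftrightarrow>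
    dual_dof1 x K N \<psi> = Matrix.vec (N * K + 1) (\<lambda>i. weak_rhs \<phi> bd (basis0 x K N i))"
    (is "?weak \<longleftrightarrow> ?dof")
proof
  assume ?weak
  with basis0_in_G dual_dof1_index[OF assms(2)] show ?dof
    by (intro eq_vecI) (auto simp: mult.commute dual_dof1_def mass0_def)
next
  assume dof: ?dof
  have b: "integral {x 0..x K} (\<lambda>t. \<psi> t * basis0 x K N i t) = weak_rhs \<phi> bd (basis0 x K N i)"
    if "i < N * K + 1" for i
    using dual_dof1_index[OF assms(2) that] dof that by (simp add: mult.commute)
  show ?weak
  proof
    fix q assume q: "q \<in> G_space x K N"
    have "integral {x 0..x K} (\<lambda>t. \<psi> t * combination0 c t) = weak_rhs \<phi> bd (combination0 c)" for c
      using b by (simp add: integral_mult_combination0[OF piecewise_poly_G[OF assms(2)]]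
          weak_rhs_combination0[OF assms(1)])
    then show "integral {x 0..x K} (\<lambda>t. \<psi> t * q t) = weak_rhs \<phi> bd q"
      using G_space_eq_combination0[OF q] by metis
  qed
qed

lemma dual_dof1_weak_deriv:
  assumes "piecewise_poly \<phi>"
  shows "weak_deriv x K N \<phi> bd \<in> G_space x K N \<and>
    dual_dof1 x K N (weak_deriv x K N \<phi> bd) =
      Matrix.vec (N * K + 1) (\<lambda>i. weak_rhs \<phi> bd (basis0 x K N i))"
    (is "_ \<and> _ = ?r")
proof -
  have ex1: "\<exists>!\<psi>. \<psi> \<in> G_space x K N \<and> dual_dof1 x K N \<psi> = ?r"
    using ex_dual_dof1[of ?r] dual_dof1_inj by (metis vec_carrier)
  \<comment> \<open>The defining condition is replaced by an equivalent one with a known unique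
    solution, so the definite description denotes that solution.\<close>
  have "weak_deriv x K N \<phi> bd = (THE \<psi>. \<psi> \<in> G_space x K N \<and> dual_dof1 x K N \<psi> = ?r)"
    unfolding weak_deriv_def weak_rhs_def[symmetric]
    by (intro arg_cong[where f = The] ext conj_cong refl weak_form_iff_dual_dof1[OF assms])
  with theI'[OF ex1] show ?thesis by (simp only:)
qed

lemma weak_rhs_basis0:
  assumes "\<phi> \<in> S_space x K N" "i < N * K + 1"
  shows "weak_rhs \<phi> bd (basis0 x K N i) =
    (if i < N * K then vec_index (dual_dof0 x K N \<phi>) i else 0)
    - (if 0 < i then vec_index (dual_dof0 x K N \<phi>) (i - 1) else 0)
    + (if i = N * K then snd bd else 0) - (if i = 0 then fst bd else 0)"
proof -
  let ?e = "basis1 x K N"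
  have int: "(\<lambda>t. ?e j t * \<phi> t) integrable_on {x 0..x K}" for j
    by (intro piecewise_poly_integrable piecewise_poly_mult piecewise_poly_basis1
        piecewise_poly_S assms)
  \<comment> \<open>The guard \<open>b\<close> is constant in \<open>t\<close>. It stands for the
    conditions that drop the missing edge at the first and at the last node.\<close>
  then have int': "(\<lambda>t. if b then ?e j t * \<phi> t else 0) integrable_on {x 0..x K}" for b j
    by (cases b) auto
  have "integral {x 0..x K} (\<lambda>t. \<phi> t * (- deriv (basis0 x K N i) t)) =
      integral {x 0..x K} (\<lambda>t. (if i < N * K then ?e i t * \<phi> t else 0)
        - (if 0 < i then ?e (i - 1) t * \<phi> t else 0))"
    by (intro integral_cong_elements) (simp add: deriv_basis0 algebra_simps)
  also have "\<dots> = integral {x 0..x K} (\<lambda>t. if i < N * K then ?e i t * \<phi> t else 0)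
      - integral {x 0..x K} (\<lambda>t. if 0 < i then ?e (i - 1) t * \<phi> t else 0)"
    by (intro integral_diff int')
  also have "\<dots> = (if i < N * K then vec_index (dual_dof0 x K N \<phi>) i else 0)
    - (if 0 < i then vec_index (dual_dof0 x K N \<phi>) (i - 1) else 0)"
    using assms(2) by (auto simp: dual_dof0_index[OF assms(1)])
  finally have "integral {x 0..x K} (\<lambda>t. \<phi> t * (- deriv (basis0 x K N i) t)) = \<dots>" .
  \<comment> \<open>The ends of the interval are the nodes with indices \<open>N * K\<close> and 0,
    so the nodal property evaluates the boundary term.\<close>
  moreover have "basis0 x K N i (x K) = (if i = N * K then 1 else 0)"
    using basis0_node[of "N * K" i] node_left[of K] by (simp add: mult.commute)
  moreover have "basis0 x K N i (x 0) = (if i = 0 then 1 else 0)"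
    using basis0_node[of 0 i] node_left[of 0] by simp
  ultimately show ?thesis by (simp add: weak_rhs_def)
qed

end

section \<open>Entries of the matrix products and the final comparison\<close>

lemma incidence_transpose_index:
  assumes "v \<in> carrier_vec M" "i < M + 1"
  shows "vec_index (- transpose_mat (incidence_mat M) *\<^sub>v v) i =
    (if i < M then vec_index v i else 0) - (if 0 < i then vec_index v (i - 1) else (0 :: real))"
proof -
  have "vec_index (- transpose_mat (incidence_mat M) *\<^sub>v v) i =
      (\<Sum>j<M. (if j = i then vec_index v j else 0) - (if i = Suc j then vec_index v j else 0))"
    using assms
    by (simp add: incidence_mat_def scalar_prod_def lessThan_atLeast0 flip: sum_negf)
      (intro sum.cong; auto)
  \<comment> \<open>Solved for \<open>j\<close>, the condition selects a single summand. The inner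
    guard excludes \<open>i = 0\<close>, where the truncated \<open>i - 1\<close> would wrongly pick
    \<open>j = 0\<close>.\<close>
  also have "(\<Sum>j<M. if i = Suc j then vec_index v j else 0) =
      (\<Sum>j<M. if j = i - 1 then if 0 < i then vec_index v j else 0 else 0)"
    by (intro sum.cong) auto
  then have "(\<Sum>j<M. (if j = i then vec_index v j else 0) - (if i = Suc j then vec_index v j else 0)) =
      (if i < M then vec_index v i else 0) - (if 0 < i then vec_index v (i - 1) else 0)"
    using assms by (auto simp: sum_subtractf)
  finally show ?thesis .
qed

lemma boundary_mat_index:
  assumes "M \<ge> 1" "i < M + 1"
  shows "vec_index (boundary_mat M *\<^sub>v boundary_dof bd) i =
    (if i = M then snd bd else 0) - (if i = 0 then fst bd else 0)"
  using assms
  by (auto simp: boundary_mat_def boundary_dof_def scalar_prod_def numeral_2_eq_2)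

theorem mainTheorem8:
  fixes x :: "nat \<Rightarrow> real" and K N :: nat
    and \<phi> :: "real \<Rightarrow> real" and bd :: "real \<times> real"
  assumes "K \<ge> 1" and "N \<ge> 1"
    and "strict_mono_on {0..K} x"
    and "\<phi> \<in> dual_S_space x K N"
  shows "weak_deriv x K N \<phi> bd \<in> dual_G_space x K N \<and>
    dual_dof1 x K N (weak_deriv x K N \<phi> bd) =
      - transpose_mat (incidence_mat (N * K)) *\<^sub>v dual_dof0 x K N \<phi>
      + boundary_mat (N * K) *\<^sub>v boundary_dof bd"
proof -
  interpret mesh x K N using assms(1-3) by unfold_locales
  have M: "N * K \<ge> 1" using assms(1,2) by simp
  have c: "dual_dof0 x K N \<phi> \<in> carrier_vec (N * K)"
    by (intro carrier_vecI) (simp add: dual_dof0_def mass1_def)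
  \<comment> \<open>The dual degrees of freedom of the weak derivative are already known to be these
    moments; they are compared with the matrix formula entry by entry.\<close>
  have "Matrix.vec (N * K + 1) (\<lambda>i. weak_rhs \<phi> bd (basis0 x K N i)) =
      - transpose_mat (incidence_mat (N * K)) *\<^sub>v dual_dof0 x K N \<phi>
      + boundary_mat (N * K) *\<^sub>v boundary_dof bd" (is "?l = ?u + ?w")
  proof (intro eq_vecI)
    show dim: "dim_vec ?l = dim_vec (?u + ?w)" by (simp add: boundary_mat_def)
    fix i assume "i < dim_vec (?u + ?w)"
    then have i: "i < N * K + 1" by (simp add: boundary_mat_def)
    then have "vec_index (?u + ?w) i = vec_index ?u i + vec_index ?w i"
      by (intro index_add_vec) (simp add: boundary_mat_def)
    then show "vec_index ?l i = vec_index (?u + ?w) i"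
      unfolding incidence_transpose_index[OF c i] boundary_mat_index[OF M i]
      using i by (simp add: weak_rhs_basis0[OF assms(4)])
  qed
  with dual_dof1_weak_deriv[OF piecewise_poly_S[OF assms(4)], of bd] show ?thesis by simp
qed

end
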